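(* The degree $D_n$ of a fixed vertex of the Moran forest $\mathscr{F}_n$ converges in distribution, as $n\to\infty$, to a random variable $D$ satisfying: (i) $D \sim \mathrm{Ber}(1-U) + \mathrm{Poisson}(U)$, where $U$ is uniform on $[0,1]$ and the Bernoulli and Poisson variables are independent conditional on $U$. (ii) $\displaystyle G_D(z) := \mathbb{E}[z^D] = \int_0^1 \bigl(1+(1-x)(z-1)\bigr)e^{x(z-1)}\,dx = 2\,\frac{e^{z-1}-1}{z-1} - 1$ (with the value of the last expression at $z=1$ understood by continuity). (iii) For all integers $p\ge 1$, $\displaystyle \mathbb{E}\bigl[D(D-1)\cdots(D-p+1)\bigr] = \frac{2}{p+1}$. (iv) $\mathbb{P}(D=0) = 1-2/e$ and, for all integers $k\ge 1$, \[ \mathbb{P}(D=k) = \frac{2}{e}\sum_{j>k}\frac{1}{j!}. \]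
   Context: Moran forest: for fixed $n\ge 2$, consider the Markov chain on directed graphs on $\{1,\ldots,n\}$ whose transitions are: at each time-step, choose an ordered pair of distinct vertices $(u,v)$ uniformly at random; disconnect $v$ from all of its neighbors (remove all edges incident to $v$), then add the edge $\vec{uv}$. This chain has a unique stationary distribution, whose support is the set of non-empty rooted forests (those with at least one edge) on $\{1,\ldots,n\}$. The Moran forest $\mathscr{F}_n$ is a random forest having this stationary distribution. The degree of a vertex is its total degree (in-degree plus out-degree); by exchangeability its law does not depend on the chosen vertex. $\mathrm{Ber}(p)$ and $\mathrm{Poisson}(\lambda)$ denote random variables with the corresponding distributions. *)

theory Defs
  imports "HOL-Probability.Probability"
begin

text \<open>A digraph on the fixed vertex set \<open>{1..n}\<close> is represented by its set of directed edges.\<close>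

definition digraphs_on :: "nat \<Rightarrow> (nat \<times> nat) set set" where
  "digraphs_on n = {E. E \<subseteq> {1..n} \<times> {1..n} \<and> (\<forall>(a, b) \<in> E. a \<noteq> b)}"

definition moran_step :: "nat \<times> nat \<Rightarrow> (nat \<times> nat) set \<Rightarrow> (nat \<times> nat) set" where
  "moran_step = (\<lambda>(u, v) E. {(a, b) \<in> E. a \<noteq> v \<and> b \<noteq> v} \<union> {(u, v)})"

text \<open>For \<open>n < 2\<close> there is no ordered pair to choose from and the kernel is meaningless.\<close>

definition moran_kernel :: "nat \<Rightarrow> (nat \<times> nat) set \<Rightarrow> (nat \<times> nat) set pmf" where
  "moran_kernel n E =
     map_pmf (\<lambda>p. moran_step p E)
       (pmf_of_set {(u, v). u \<in> {1..n} \<and> v \<in> {1..n} \<and> u \<noteq> v})"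

definition moran_stationary :: "nat \<Rightarrow> (nat \<times> nat) set pmf \<Rightarrow> bool" where
  "moran_stationary n \<mu> \<longleftrightarrow>
     set_pmf \<mu> \<subseteq> digraphs_on n \<and> bind_pmf \<mu> (moran_kernel n) = \<mu>"

text \<open>The law of the Moran forest. For \<open>n \<ge> 2\<close> the stationary distribution exists and is unique.\<close>

definition moran_forest :: "nat \<Rightarrow> (nat \<times> nat) set pmf" where
  "moran_forest n = (THE \<mu>. moran_stationary n \<mu>)"

definition total_degree :: "(nat \<times> nat) set \<Rightarrow> nat \<Rightarrow> nat" where
  "total_degree E v = card {a. (a, v) \<in> E} + card {b. (v, b) \<in> E}"

text \<open>The law of \<open>Ber(1 - x) + Poisson(x)\<close> with independent summands. The library's
  \<open>poisson_pmf\<close> is only specified for a positive rate; \<open>Poisson(0)\<close> is the point mass at 0.\<close>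

definition ber_plus_poisson :: "real \<Rightarrow> nat pmf" where
  "ber_plus_poisson x =
     map_pmf (\<lambda>(b, k). of_bool b + k)
       (pair_pmf (bernoulli_pmf (1 - x)) (if x = 0 then return_pmf 0 else poisson_pmf x))"

text \<open>The law of \<open>Ber(1 - U) + Poisson(U)\<close>, where \<open>U\<close> is uniform on \<open>[0, 1]\<close> and, conditionally
  on \<open>U\<close>, the summands are independent. The law of \<open>U\<close> is taken as a measure with space \<open>[0, 1]\<close>
  because the Bernoulli and Poisson laws make no sense for other parameters.\<close>

definition mixed_ber_poisson :: "nat measure" where
  "mixed_ber_poisson =
     uniform_measure (restrict_space lborel {0..1}) {0..1} \<bind>
       (\<lambda>x. measure_pmf (ber_plus_poisson x))"

end

theory Submission
  imports Defs "HOL-Real_Asymp.Real_Asymp"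
begin

text \<open>Follow the degree of the vertex \<open>v\<close> along the chain. It is reset to 1 when \<open>v\<close> is
  disconnected, it grows by 1 when \<open>v\<close> is chosen as the new neighbour of a non-adjacent vertex, and it
  drops by 1 when a neighbour of \<open>v\<close> is moved elsewhere. These rates depend on the graph only through
  the degree, and they are affine in it, so the generator maps polynomials of degree \<open>p\<close> to
  polynomials of degree at most \<open>p\<close>. On the basis of binomial coefficients it is even triangular with two
  diagonals, and stationarity becomes a first-order recurrence for the binomial moments
  (\<open>degree_moment_recurrence\<close>). Its solution is at most \<open>2 / (p + 1)!\<close> for \<open>p \<ge> 1\<close> and converges to
  this value.

  The binomial moments are the Taylor coefficients of the generating function at \<open>z = 1\<close>. Since they
  are dominated by a summable sequence, the generating functions converge, for complex \<open>z \<noteq> 1\<close>, to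
  \<open>2 * (exp (z - 1) - 1) / (z - 1) - 1\<close> (\<open>degree_gf_tendsto\<close>), and Levy's continuity theorem, applied
  on the unit circle, gives convergence in distribution.

  The limit law is constructed as the mixture of \<open>Ber(1 - x) + Poisson(x)\<close>. Its probabilities are
  computed first (\<open>pmf_limit_degree\<close>), through an explicit antiderivative of the conditional
  probabilities. Up to a correction at 0 they are multiples of the tails of the exponential series,
  whose differences are simple, so the generating function and the factorial moments follow by
  telescoping.

  The Moran forest is defined through a description, so all of this rests on existence and
  uniqueness of the stationary law, which hold for every finite kernel with a state that is
  reached from all states in the same number of steps (\<open>finite_kernel_unique_stationary\<close>). Here
  that state is the star centred at vertex 1.\<close>

section \<open>Stationary laws of finite kernels\<close>

primrec kernel_power :: "('a \<Rightarrow> 'a pmf) \<Rightarrow> nat \<Rightarrow> 'a \<Rightarrow> 'a pmf" where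
  "kernel_power K 0 x = return_pmf x"
| "kernel_power K (Suc j) x = bind_pmf (K x) (kernel_power K j)"

lemma kernel_power_add:
  "kernel_power K (i + j) x = bind_pmf (kernel_power K i x) (kernel_power K j)"
proof (induction i arbitrary: x)
  case (Suc i)
  have "kernel_power K (Suc i + j) x = bind_pmf (K x) (\<lambda>y. kernel_power K (i + j) y)"
    by simp
  also have "\<dots> = bind_pmf (K x) (\<lambda>y. bind_pmf (kernel_power K i y) (kernel_power K j))"
    by (simp only: Suc)
  finally show ?case by (simp add: bind_assoc_pmf)
qed (simp add: bind_return_pmf)

lemma kernel_power_Suc_right:
  "kernel_power K (Suc j) x = bind_pmf (kernel_power K j x) K"
proof -
  have "kernel_power K 0 = return_pmf" by (rule ext) simp
  then have "kernel_power K 1 = K" by (intro ext) (simp add: bind_return_pmf')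
  with kernel_power_add[of K j 1 x] show ?thesis by simp
qed

lemma set_kernel_power:
  assumes "\<And>x. x \<in> S \<Longrightarrow> set_pmf (K x) \<subseteq> S" "x \<in> S"
  shows "set_pmf (kernel_power K j x) \<subseteq> S"
  using assms(2) by (induction j arbitrary: x) (use assms(1) in fastforce)+

lemma bind_kernel_power_stationary:
  assumes "bind_pmf \<mu> K = \<mu>"
  shows "bind_pmf \<mu> (kernel_power K j) = \<mu>"
proof (induction j)
  case (Suc j)
  have "bind_pmf \<mu> (\<lambda>x. kernel_power K (Suc j) x) = bind_pmf (bind_pmf \<mu> K) (kernel_power K j)"
    by (simp add: bind_assoc_pmf)
  with Suc assms show ?case by simp
qed (simp add: bind_return_pmf')

lemma expectation_finite_support:
  fixes h :: "'a \<Rightarrow> real"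
  assumes "finite S" "set_pmf p \<subseteq> S"
  shows "measure_pmf.expectation p h = (\<Sum>x\<in>S. pmf p x * h x)"
  using assms by (subst integral_measure_pmf_real[where A = S]) (auto simp: mult.commute)

text \<open>The averaging step behind the contraction below: mass at least \<open>\<epsilon>\<close> sits on the single point
  \<open>y\<close>, so the mean stays away from both ends of the range of \<open>h\<close> by an amount governed by \<open>h y\<close>,
  whatever the rest of \<open>p\<close> looks like.\<close>
lemma expectation_between:
  fixes h :: "'a \<Rightarrow> real"
  assumes "finite S" "set_pmf p \<subseteq> S" "y \<in> S" "\<And>x. x \<in> S \<Longrightarrow> a \<le> h x \<and> h x \<le> b"
    and "0 \<le> \<epsilon>" "\<epsilon> \<le> pmf p y"
  shows "a + \<epsilon> * (h y - a) \<le> measure_pmf.expectation p h"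
    and "measure_pmf.expectation p h \<le> b - \<epsilon> * (b - h y)"
proof -
  have one: "(\<Sum>x\<in>S. pmf p x) = 1"
    using assms(1,2) by (simp add: sum_pmf_eq_1)
  have "(\<Sum>x\<in>S. pmf p x * h x) - a = (\<Sum>x\<in>S. pmf p x * (h x - a))"
    by (simp add: right_diff_distrib sum_subtractf flip: sum_distrib_right) (simp add: one)
  also have "\<dots> \<ge> pmf p y * (h y - a)"
    by (rule member_le_sum) (use assms in auto)
  finally have *: "pmf p y * (h y - a) \<le> (\<Sum>x\<in>S. pmf p x * h x) - a" .
  have "\<epsilon> * (h y - a) \<le> pmf p y * (h y - a)"
    using assms by (intro mult_right_mono) auto
  with * show "a + \<epsilon> * (h y - a) \<le> measure_pmf.expectation p h"
    by (simp add: expectation_finite_support[OF assms(1,2)])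
  have "b - (\<Sum>x\<in>S. pmf p x * h x) = (\<Sum>x\<in>S. pmf p x * (b - h x))"
    by (simp add: right_diff_distrib sum_subtractf flip: sum_distrib_right) (simp add: one)
  also have "\<dots> \<ge> pmf p y * (b - h y)"
    by (rule member_le_sum) (use assms in auto)
  finally have *: "pmf p y * (b - h y) \<le> b - (\<Sum>x\<in>S. pmf p x * h x)" .
  have "\<epsilon> * (b - h y) \<le> pmf p y * (b - h y)"
    using assms by (intro mult_right_mono) auto
  with * show "measure_pmf.expectation p h \<le> b - \<epsilon> * (b - h y)"
    by (simp add: expectation_finite_support[OF assms(1,2)])
qed

lemma pmf_kernel_power_add:
  "pmf (kernel_power K (i + j) x) z =
     measure_pmf.expectation (kernel_power K i x) (\<lambda>y. pmf (kernel_power K j y) z)"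
  by (simp add: kernel_power_add pmf_bind)

text \<open>Doeblin's argument. As a function of the starting point, \<open>pmf (kernel_power K j x) z\<close> has a
  maximum over \<open>S\<close> that decreases in \<open>j\<close> and a minimum that increases, because one more step
  averages it. All \<open>m\<close>-step laws share an atom of mass \<open>\<epsilon>\<close> at \<open>y\<close>, so every \<open>m\<close> steps the gap between
  the two shrinks by the factor \<open>1 - \<epsilon>\<close>. The limit is therefore independent of the starting point.\<close>
lemma kernel_power_converges:
  assumes fin: "finite S" and closed: "\<And>x. x \<in> S \<Longrightarrow> set_pmf (K x) \<subseteq> S"
    and y: "y \<in> S" and reach: "\<And>x. x \<in> S \<Longrightarrow> y \<in> set_pmf (kernel_power K m x)"
  shows "\<exists>L. \<forall>x\<in>S. (\<lambda>j. pmf (kernel_power K j x) z) \<longlonglongrightarrow> L"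
proof -
  define h where "h j x = pmf (kernel_power K j x) z" for j x
  define a where "a j = Min (h j ` S)" for j
  define b where "b j = Max (h j ` S)" for j
  define \<epsilon> where "\<epsilon> = Min ((\<lambda>x. pmf (kernel_power K m x) y) ` S)"
  have ne: "S \<noteq> {}" using y by auto
  have supp: "set_pmf (kernel_power K j x) \<subseteq> S" if "x \<in> S" for j x
    using set_kernel_power[of S K x j] closed that by blast
  have ab: "a j \<le> h j x" "h j x \<le> b j" if "x \<in> S" for j x
    using fin that by (auto simp: a_def b_def)
  have abI: "a j \<ge> c" "b j \<le> d" if "\<And>x. x \<in> S \<Longrightarrow> c \<le> h j x \<and> h j x \<le> d" for j c d
    using fin ne that by (auto simp: a_def b_def)
  have \<epsilon>: "0 < \<epsilon>" "\<And>x. x \<in> S \<Longrightarrow> \<epsilon> \<le> pmf (kernel_power K m x) y"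
    using fin ne reach by (auto simp: \<epsilon>_def pmf_positive)
  have h_add: "h (i + j) x = measure_pmf.expectation (kernel_power K i x) (h j)" for i j x
    unfolding h_def by (rule pmf_kernel_power_add)
  have mono: "a j \<le> a (Suc j)" "b (Suc j) \<le> b j" for j
  proof -
    have "a j \<le> h (1 + j) x \<and> h (1 + j) x \<le> b j" if "x \<in> S" for x
      using expectation_between[OF fin supp[OF that, where j = 1] y,
          where a = "a j" and b = "b j" and h = "h j" and \<epsilon> = 0] ab
      unfolding h_add by simp
    from abI[OF this] show "a j \<le> a (Suc j)" "b (Suc j) \<le> b j" by simp_all
  qed
  have gap: "b (m + j) - a (m + j) \<le> (1 - \<epsilon>) * (b j - a j)" for j
  proof -
    have "a j + \<epsilon> * (h j y - a j) \<le> h (m + j) x \<and> h (m + j) x \<le> b j - \<epsilon> * (b j - h j y)"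
      if "x \<in> S" for x
      using expectation_between[OF fin supp[OF that, where j = m] y,
          where a = "a j" and b = "b j" and h = "h j" and \<epsilon> = \<epsilon>] ab \<epsilon> that
      unfolding h_add by simp
    from abI[OF this] show ?thesis by (simp add: algebra_simps)
  qed
  have "decseq b" using mono by (simp add: decseq_SucI)
  have "incseq a" using mono by (simp add: incseq_SucI)
  have "b j \<ge> 0" for j using ab(2)[OF y, of j] by (simp add: h_def order.trans[OF pmf_nonneg])
  then obtain B where B: "b \<longlonglongrightarrow> B" using decseq_convergent[OF \<open>decseq b\<close>, of 0] by blast
  have "a j \<le> 1" for j using ab(1)[OF y, of j] pmf_le_1[of _ z] unfolding h_def by (rule order.trans)
  then obtain A where A: "a \<longlonglongrightarrow> A" using incseq_convergent[OF \<open>incseq a\<close>, of 1] by blast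
  \<comment> \<open>Passing to the limit in \<open>gap\<close> forces the limiting gap \<open>B - A\<close> to vanish.\<close>
  have "B - A \<le> (1 - \<epsilon>) * (B - A)"
  proof (rule LIMSEQ_le)
    show "(\<lambda>j. b (m + j) - a (m + j)) \<longlonglongrightarrow> B - A"
      using LIMSEQ_ignore_initial_segment[OF tendsto_diff[OF B A], of m] by (simp add: add.commute)
    show "(\<lambda>j. (1 - \<epsilon>) * (b j - a j)) \<longlonglongrightarrow> (1 - \<epsilon>) * (B - A)"
      by (intro tendsto_intros A B)
  qed (use gap in auto)
  then have "\<epsilon> * (B - A) \<le> 0" by (simp add: algebra_simps)
  with \<epsilon> have "B \<le> A" by (simp add: mult_le_0_iff)
  moreover have "A \<le> B"
    using A B by (rule LIMSEQ_le) (use ab[OF y] order.trans in blast)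
  ultimately have "A = B" by simp
  have "(\<lambda>j. h j x) \<longlonglongrightarrow> B" if "x \<in> S" for x
    by (rule real_tendsto_sandwich[OF _ _ A[unfolded \<open>A = B\<close>] B]) (use ab[OF that] in auto)
  then show ?thesis by (auto simp: h_def)
qed

text \<open>The common limit of the \<open>j\<close>-step laws is stationary, since applying \<open>K\<close> once more only shifts
  \<open>j\<close>. It is the only stationary law, since a stationary \<open>\<mu>\<close> is the \<open>\<mu>\<close>-average of \<open>j\<close>-step laws for
  every \<open>j\<close>.\<close>
theorem finite_kernel_unique_stationary:
  assumes fin: "finite S" and closed: "\<And>x. x \<in> S \<Longrightarrow> set_pmf (K x) \<subseteq> S"
    and y: "y \<in> S" and reach: "\<And>x. x \<in> S \<Longrightarrow> y \<in> set_pmf (kernel_power K m x)"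
  shows "\<exists>!\<mu>. set_pmf \<mu> \<subseteq> S \<and> bind_pmf \<mu> K = \<mu>"
proof -
  obtain L where L: "\<And>x z. x \<in> S \<Longrightarrow> (\<lambda>j. pmf (kernel_power K j x) z) \<longlonglongrightarrow> L z"
    using kernel_power_converges[OF fin closed y reach] by metis
  have supp: "set_pmf (kernel_power K j x) \<subseteq> S" if "x \<in> S" for j x
    using set_kernel_power[of S K x j] closed that by blast
  have nonneg: "L z \<ge> 0" for z
    by (rule LIMSEQ_le_const[OF L[OF y]]) simp
  have outside: "L z = 0" if "z \<notin> S" for z
  proof -
    have "pmf (kernel_power K j y) z = 0" for j
      using supp[OF y, of j] that by (auto simp: set_pmf_eq)
    with L[OF y, of z] show ?thesis by (simp add: LIMSEQ_const_iff)
  qed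
  have "(\<lambda>j. \<Sum>z\<in>S. pmf (kernel_power K j y) z) \<longlonglongrightarrow> (\<Sum>z\<in>S. L z)"
    by (intro tendsto_sum L y)
  then have total: "(\<Sum>z\<in>S. L z) = 1"
    using supp[OF y] fin by (simp add: sum_pmf_eq_1 LIMSEQ_const_iff)
  have "(\<integral>\<^sup>+z. ennreal (L z) \<partial>count_space UNIV) = (\<Sum>z\<in>S. ennreal (L z))"
    by (rule nn_integral_count_space') (use fin outside in auto)
  then have prob: "(\<integral>\<^sup>+z. ennreal (L z) \<partial>count_space UNIV) = 1"
    by (simp add: nonneg sum_ennreal total)
  define \<pi> where "\<pi> = embed_pmf L"
  have pmf_\<pi>: "pmf \<pi> z = L z" for z
    unfolding \<pi>_def using nonneg prob by (rule pmf_embed_pmf)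
  have set_\<pi>: "set_pmf \<pi> \<subseteq> S"
    using outside by (auto simp: set_pmf_eq pmf_\<pi>)
  have "pmf (bind_pmf \<pi> K) z = pmf \<pi> z" for z
  proof -
    have "(\<lambda>j. \<Sum>x\<in>S. pmf (kernel_power K j y) x * pmf (K x) z) \<longlonglongrightarrow> (\<Sum>x\<in>S. L x * pmf (K x) z)"
      by (intro tendsto_intros L y)
    moreover have "(\<Sum>x\<in>S. pmf (kernel_power K j y) x * pmf (K x) z) = pmf (kernel_power K (Suc j) y) z" for j
      unfolding kernel_power_Suc_right pmf_bind
      by (simp add: expectation_finite_support[OF fin supp[OF y]])
    ultimately have "(\<lambda>j. pmf (kernel_power K (Suc j) y) z) \<longlonglongrightarrow> (\<Sum>x\<in>S. L x * pmf (K x) z)"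
      by simp
    from LIMSEQ_unique[OF this LIMSEQ_Suc[OF L[OF y]]] show ?thesis
      by (simp add: pmf_bind expectation_finite_support[OF fin set_\<pi>] pmf_\<pi>)
  qed
  then have "bind_pmf \<pi> K = \<pi>" by (rule pmf_eqI)
  moreover have "\<mu> = \<pi>" if \<mu>: "set_pmf \<mu> \<subseteq> S" "bind_pmf \<mu> K = \<mu>" for \<mu>
  proof (rule pmf_eqI)
    fix z
    have "(\<lambda>j. \<Sum>x\<in>S. pmf \<mu> x * pmf (kernel_power K j x) z) \<longlonglongrightarrow> (\<Sum>x\<in>S. pmf \<mu> x * L z)"
      by (intro tendsto_intros L)
    moreover have "(\<Sum>x\<in>S. pmf \<mu> x * pmf (kernel_power K j x) z) = pmf \<mu> z" for j
      by (subst (2) bind_kernel_power_stationary[OF \<mu>(2), symmetric, of j])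
         (simp add: pmf_bind expectation_finite_support[OF fin \<mu>(1)])
    moreover have "(\<Sum>x\<in>S. pmf \<mu> x * L z) = L z"
      using sum_pmf_eq_1[OF fin \<mu>(1)] by (simp flip: sum_distrib_right)
    ultimately show "pmf \<mu> z = pmf \<pi> z" by (simp add: LIMSEQ_const_iff pmf_\<pi>)
  qed
  ultimately show ?thesis using set_\<pi> by blast
qed

section \<open>The Moran chain\<close>

definition vertex_pairs :: "nat \<Rightarrow> (nat \<times> nat) set" where
  "vertex_pairs n = {(u, v). u \<in> {1..n} \<and> v \<in> {1..n} \<and> u \<noteq> v}"

definition star_graph :: "nat \<Rightarrow> (nat \<times> nat) set" where
  "star_graph n = {1} \<times> {2..n}"

lemma vertex_pairs_eq: "vertex_pairs n = (SIGMA w:{1..n}. {1..n} - {w})"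
  by (auto simp: vertex_pairs_def)

lemma finite_vertex_pairs: "finite (vertex_pairs n)"
  by (simp add: vertex_pairs_eq)

lemma card_vertex_pairs: "card (vertex_pairs n) = n * (n - 1)"
  by (simp add: vertex_pairs_eq)

lemma vertex_pairs_nonempty:
  assumes "n \<ge> 2"
  shows "vertex_pairs n \<noteq> {}"
  using card_vertex_pairs[of n] assms by auto

lemma set_moran_kernel:
  assumes "n \<ge> 2"
  shows "set_pmf (moran_kernel n E) = (\<lambda>p. moran_step p E) ` vertex_pairs n"
  using vertex_pairs_nonempty[OF assms] finite_vertex_pairs[of n]
  unfolding moran_kernel_def vertex_pairs_def by simp

lemma finite_digraphs_on: "finite (digraphs_on n)"
  by (rule finite_subset[of _ "Pow ({1..n} \<times> {1..n})"]) (auto simp: digraphs_on_def)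

lemma moran_step_digraph:
  assumes "p \<in> vertex_pairs n" "E \<in> digraphs_on n"
  shows "moran_step p E \<in> digraphs_on n"
  using assms by (fastforce simp: moran_step_def vertex_pairs_def digraphs_on_def)

lemma moran_step_asym:
  assumes "p \<in> vertex_pairs n" "asym E"
  shows "asym (moran_step p E)"
  using assms by (fastforce simp: moran_step_def vertex_pairs_def intro!: asymI dest: asymD)

lemma fold_moran_step_in_kernel_power:
  assumes "n \<ge> 2" "set ps \<subseteq> vertex_pairs n"
  shows "fold moran_step ps E \<in> set_pmf (kernel_power (moran_kernel n) (length ps) E)"
  using assms(2) by (induction ps arbitrary: E) (auto simp: set_moran_kernel[OF assms(1)])

lemma fold_moran_step_star:
  assumes "1 \<notin> set ws"
  shows "fold moran_step (map (Pair 1) ws) E =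
    {(a, b) \<in> E. a \<notin> set ws \<and> b \<notin> set ws} \<union> {1} \<times> set ws"
  using assms by (induction ws arbitrary: E) (auto simp: moran_step_def)

text \<open>The choices \<open>(2, 1), (1, 2), (1, 3), \<dots>, (1, n)\<close> reset every vertex once, so nothing of the
  initial graph survives. The first choice removes the edges at vertex 1, which is never reset
  afterwards, and the edge \<open>(2, 1)\<close> that it creates disappears when vertex 2 is reset.\<close>
lemma star_graph_reachable:
  assumes "n \<ge> 2" "E \<in> digraphs_on n"
  shows "star_graph n \<in> set_pmf (kernel_power (moran_kernel n) n E)"
proof -
  define ps :: "(nat \<times> nat) list" where "ps = (2, 1) # map (Pair 1) [2..<Suc n]"
  have "moran_step (2, 1) E \<in> digraphs_on n"
    using assms by (intro moran_step_digraph) (auto simp: vertex_pairs_def)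
  then have "fold moran_step ps E = star_graph n"
    unfolding ps_def star_graph_def fold_Cons o_apply
    by (subst fold_moran_step_star) (fastforce simp: digraphs_on_def)+
  moreover have "set ps \<subseteq> vertex_pairs n" "length ps = n"
    using assms by (auto simp: ps_def vertex_pairs_def)
  ultimately show ?thesis
    using fold_moran_step_in_kernel_power[OF assms(1), of ps E] by simp
qed

lemma star_graph_digraph: "star_graph n \<in> digraphs_on n"
  by (auto simp: star_graph_def digraphs_on_def)

lemma star_graph_asym: "asym (star_graph n)"
  by (rule asymI) (auto simp: star_graph_def)

lemma moran_stationary_unique:
  assumes "n \<ge> 2"
  shows "\<exists>!\<mu>. moran_stationary n \<mu>"
  unfolding moran_stationary_def
proof (rule finite_kernel_unique_stationary[where m = n])
  show "set_pmf (moran_kernel n E) \<subseteq> digraphs_on n" if "E \<in> digraphs_on n" for E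
    using that by (auto simp: set_moran_kernel[OF assms] moran_step_digraph)
qed (use assms finite_digraphs_on star_graph_digraph star_graph_reachable in auto)

theorem moran_forest_stationary:
  assumes "n \<ge> 2"
  shows "moran_stationary n (moran_forest n)"
  unfolding moran_forest_def using moran_stationary_unique[OF assms] by (rule theI')

lemma moran_forest_digraph:
  assumes "n \<ge> 2"
  shows "set_pmf (moran_forest n) \<subseteq> digraphs_on n"
  using moran_forest_stationary[OF assms] by (simp add: moran_stationary_def)

text \<open>Degrees count edges and not neighbours, so pairs of opposite edges must be excluded. A step
  never creates such a pair, so the graphs without one form a closed set containing the star; the
  chain restricted to it has a stationary law, which by uniqueness is the Moran forest.\<close>
lemma moran_forest_asym:
  assumes "n \<ge> 2" "E \<in> set_pmf (moran_forest n)"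
  shows "asym E"
proof -
  have "\<exists>!\<mu>. set_pmf \<mu> \<subseteq> {E \<in> digraphs_on n. asym E} \<and> bind_pmf \<mu> (moran_kernel n) = \<mu>"
  proof (rule finite_kernel_unique_stationary[where m = n])
    show "set_pmf (moran_kernel n E) \<subseteq> {E \<in> digraphs_on n. asym E}"
      if "E \<in> {E \<in> digraphs_on n. asym E}" for E
      using that by (auto simp: set_moran_kernel[OF assms(1)] moran_step_digraph moran_step_asym)
  qed (use assms finite_digraphs_on star_graph_digraph star_graph_asym star_graph_reachable in auto)
  then obtain \<mu> where \<mu>: "set_pmf \<mu> \<subseteq> {E \<in> digraphs_on n. asym E}" "moran_stationary n \<mu>"
    unfolding moran_stationary_def by blast
  with moran_stationary_unique[OF assms(1)] moran_forest_stationary[OF assms(1)]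
  have "moran_forest n = \<mu>" by blast
  with \<mu> assms(2) show ?thesis by blast
qed

text \<open>Stationarity tested against an observable \<open>g\<close>, multiplied by the number of ordered pairs to
  clear denominators.\<close>
lemma moran_forest_expectation_step:
  fixes g :: "(nat \<times> nat) set \<Rightarrow> real"
  assumes "n \<ge> 2"
  shows "real (n * (n - 1)) * measure_pmf.expectation (moran_forest n) g =
    measure_pmf.expectation (moran_forest n) (\<lambda>E. \<Sum>p\<in>vertex_pairs n. g (moran_step p E))"
proof -
  note ne = vertex_pairs_nonempty[OF assms]
  have fin: "finite (set_pmf (moran_kernel n E))" for E
    by (simp add: set_moran_kernel[OF assms] finite_vertex_pairs)
  have kernel: "measure_pmf.expectation (moran_kernel n E) g =
      (\<Sum>p\<in>vertex_pairs n. g (moran_step p E)) / real (n * (n - 1))" for E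
    unfolding moran_kernel_def vertex_pairs_def[symmetric]
    using ne finite_vertex_pairs[of n]
    by (simp add: integral_pmf_of_set card_vertex_pairs)
  have "measure_pmf.expectation (bind_pmf (moran_forest n) (moran_kernel n)) g =
      measure_pmf.expectation (moran_forest n) (\<lambda>E. measure_pmf.expectation (moran_kernel n E) g)"
    using pmf_expectation_bind[OF finite_digraphs_on fin moran_forest_digraph[OF assms], where h = g]
    by (simp add: expectation_finite_support[OF finite_digraphs_on moran_forest_digraph[OF assms]])
  also have "bind_pmf (moran_forest n) (moran_kernel n) = moran_forest n"
    using moran_forest_stationary[OF assms] by (simp add: moran_stationary_def)
  finally show ?thesis using assms by (simp add: kernel)
qed

section \<open>Binomial moments of the degree\<close>

definition neighbours :: "(nat \<times> nat) set \<Rightarrow> nat \<Rightarrow> nat set" where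
  "neighbours E v = {a. (a, v) \<in> E \<or> (v, a) \<in> E}"

lemma neighbours_subset:
  assumes "E \<in> digraphs_on n"
  shows "neighbours E v \<subseteq> {1..n} - {v}"
  using assms by (fastforce simp: neighbours_def digraphs_on_def)

lemma total_degree_eq_card_neighbours:
  assumes "asym E" "E \<in> digraphs_on n"
  shows "total_degree E v = card (neighbours E v)"
proof -
  have "neighbours E v = {a. (a, v) \<in> E} \<union> {b. (v, b) \<in> E}"
    by (auto simp: neighbours_def)
  moreover have "finite (neighbours E v)"
    using neighbours_subset[OF assms(2)] by (rule finite_subset) simp
  ultimately show ?thesis
    unfolding total_degree_def using assms(1)
    by (subst card_Un_disjoint[symmetric]) (auto dest: asymD)
qed

lemma neighbours_moran_step:
  assumes "u \<noteq> v" "w \<noteq> v"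
  shows "neighbours (moran_step (u, v) E) v = {u}"
    and "neighbours (moran_step (v, w) E) v = insert w (neighbours E v)"
    and "neighbours (moran_step (u, w) E) v = neighbours E v - {w}"
  using assms by (auto simp: neighbours_def moran_step_def)

lemma sum_vertex_pairs:
  fixes f :: "nat \<times> nat \<Rightarrow> real"
  assumes "v \<in> {1..n}"
  shows "(\<Sum>p\<in>vertex_pairs n. f p) =
    (\<Sum>u\<in>{1..n} - {v}. f (u, v)) + (\<Sum>w\<in>{1..n} - {v}. f (v, w)) +
    (\<Sum>w\<in>{1..n} - {v}. \<Sum>u\<in>{1..n} - {v} - {w}. f (u, w))"
proof -
  define V where "V = {1..n} - {v}"
  have V: "finite V" by (simp add: V_def)
  have split: "vertex_pairs n =
      ((\<lambda>u. (u, v)) ` V \<union> Pair v ` V) \<union> (\<lambda>(w, u). (u, w)) ` (SIGMA w:V. V - {w})"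
    using assms by (auto simp: vertex_pairs_def V_def image_iff)
  have "(\<Sum>p\<in>vertex_pairs n. f p) =
      (\<Sum>p\<in>(\<lambda>u. (u, v)) ` V. f p) + (\<Sum>p\<in>Pair v ` V. f p) +
      (\<Sum>p\<in>(\<lambda>(w, u). (u, w)) ` (SIGMA w:V. V - {w}). f p)"
    unfolding split using V
    by (subst sum.union_disjoint, simp, simp, force simp: V_def)
       (subst sum.union_disjoint, auto simp: V_def)
  also have "(\<Sum>p\<in>(\<lambda>(w, u). (u, w)) ` (SIGMA w:V. V - {w}). f p) =
      (\<Sum>(w, u)\<in>(SIGMA w:V. V - {w}). f (u, w))"
    by (subst sum.reindex) (auto intro!: inj_onI sum.cong)
  also have "\<dots> = (\<Sum>w\<in>V. \<Sum>u\<in>V - {w}. f (u, w))"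
    using V by (subst sum.Sigma) auto
  finally show ?thesis
    by (simp add: sum.reindex inj_on_def V_def)
qed

text \<open>The number \<open>k\<close> of neighbours of \<open>v\<close> is itself a Markov chain. Of the pairs \<open>(u, w)\<close> to choose
  from, \<open>n - 1\<close> reset \<open>v\<close>, giving degree 1; \<open>n - 1\<close> attach some \<open>w\<close> to \<open>v\<close>, which raises the degree
  unless \<open>w\<close> is a neighbour already; and each of the \<open>n - 1\<close> vertices \<open>w \<noteq> v\<close> is reset by \<open>n - 2\<close>
  further pairs, which lowers the degree if \<open>w\<close> is a neighbour.\<close>
lemma sum_over_neighbours_moran_step:
  fixes f :: "nat \<Rightarrow> real"
  assumes "E \<in> digraphs_on n" "v \<in> {1..n}"
  defines "k \<equiv> card (neighbours E v)"
  shows "(\<Sum>p\<in>vertex_pairs n. f (card (neighbours (moran_step p E) v))) =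
    (real n - 1) * f 1 + (real k * f k + (real n - 1 - real k) * f (Suc k)) +
    (real n - 2) * (real k * f (k - 1) + (real n - 1 - real k) * f k)"
proof -
  define V where "V = {1..n} - {v}"
  define N where "N = neighbours E v"
  have N: "N \<subseteq> V" "finite V" "finite N"
    using neighbours_subset[OF assms(1), of v] by (auto simp: N_def V_def intro: finite_subset)
  have card_V: "real (card V) = real n - 1"
    using assms(2) by (simp add: V_def of_nat_diff)
  have card_VN: "real (card (V - N)) = real n - 1 - real k"
    using N card_V by (simp add: card_Diff_subset card_mono of_nat_diff k_def N_def)
  have split: "sum g V = sum g N + sum g (V - N)" for g :: "nat \<Rightarrow> real"
    using N by (metis add.commute sum.subset_diff)
  have k: "card N = k" by (simp add: k_def N_def)
  \<comment> \<open>\<open>Suc v\<close> below only instantiates a vertex different from \<open>v\<close> that the fact does not mention.\<close>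
  have 1: "(\<Sum>u\<in>V. f (card (neighbours (moran_step (u, v) E) v))) = (real n - 1) * f 1"
  proof -
    have "(\<Sum>u\<in>V. f (card (neighbours (moran_step (u, v) E) v))) = (\<Sum>u\<in>V. f 1)"
      by (intro sum.cong) (auto simp: V_def neighbours_moran_step(1)[where w = "Suc v"])
    with card_V show ?thesis by simp
  qed
  have 2: "(\<Sum>w\<in>V. f (card (neighbours (moran_step (v, w) E) v))) =
      real k * f k + (real n - 1 - real k) * f (Suc k)"
  proof -
    have "(\<Sum>w\<in>V. f (card (neighbours (moran_step (v, w) E) v))) = (\<Sum>w\<in>V. f (card (insert w N)))"
      by (intro sum.cong) (auto simp: V_def N_def neighbours_moran_step(2)[where u = "Suc v"])
    also have "(\<Sum>w\<in>N. f (card (insert w N))) = real k * f k"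
      by (simp add: insert_absorb k)
    moreover have "(\<Sum>w\<in>V - N. f (card (insert w N))) = (real n - 1 - real k) * f (Suc k)"
      using N by (simp add: k card_VN)
    ultimately show ?thesis by (simp add: split)
  qed
  have 3: "(\<Sum>w\<in>V. \<Sum>u\<in>V - {w}. f (card (neighbours (moran_step (u, w) E) v))) =
      (real n - 2) * (real k * f (k - 1) + (real n - 1 - real k) * f k)"
  proof -
    have "(\<Sum>w\<in>V. \<Sum>u\<in>V - {w}. f (card (neighbours (moran_step (u, w) E) v))) =
        (\<Sum>w\<in>V. \<Sum>u\<in>V - {w}. f (card (N - {w})))"
      by (intro sum.cong) (auto simp: V_def N_def neighbours_moran_step(3))
    also have "\<dots> = (\<Sum>w\<in>V. (real n - 2) * f (card (N - {w})))"
    proof (intro sum.cong refl)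
      fix w assume "w \<in> V"
      then have "card V = Suc (card (V - {w}))"
        using N by (intro card.remove) auto
      with card_V have "real (card (V - {w})) = real n - 2"
        by linarith
      then show "(\<Sum>u\<in>V - {w}. f (card (N - {w}))) = (real n - 2) * f (card (N - {w}))"
        by simp
    qed
    also have "\<dots> = (real n - 2) * (\<Sum>w\<in>V. f (card (N - {w})))"
      by (simp add: sum_distrib_left)
    also have "(\<Sum>w\<in>N. f (card (N - {w}))) = real k * f (k - 1)"
      using N by (simp add: k)
    moreover have "(\<Sum>w\<in>V - N. f (card (N - {w}))) = (real n - 1 - real k) * f k"
      by (simp add: k card_VN)
    ultimately show ?thesis by (simp add: split)
  qed
  show ?thesis
    unfolding sum_vertex_pairs[OF assms(2)] V_def[symmetric] 1 2 3 ..
qed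

text \<open>The reason for working with binomial coefficients: the generator of the degree chain maps
  \<open>k choose Suc q\<close> to a combination of \<open>k choose Suc q\<close>, \<open>k choose q\<close> and a constant, so the
  equations for the binomial moments are triangular.\<close>
lemma binomial_generator:
  fixes n :: real
  shows "(n - 1) * real (1 choose Suc q) +
    (real k * real (k choose Suc q) + (n - 1 - real k) * real (Suc k choose Suc q)) +
    (n - 2) * (real k * real (k - 1 choose Suc q) + (n - 1 - real k) * real (k choose Suc q)) =
    (n - 1) * of_bool (q = 0) + (n - 1 - real q) * real (k choose q) +
    (n - 1) * (n - 1 - real (Suc q)) * real (k choose Suc q)"
proof -
  define c where "c = real (k choose q)"
  define d where "d = real (k choose Suc q)"
  have 1: "real (1 choose Suc q) = of_bool (q = 0)"
    by (cases q) auto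
  have 2: "real (Suc k choose Suc q) = c + d"
    by (simp add: c_def d_def)
  have 3: "real k * real (k - 1 choose Suc q) = (real k - real (Suc q)) * d"
  proof (cases "Suc q \<le> k")
    case True
    have "(k - Suc q) * (k choose Suc q) = k * (k - 1 choose Suc q)"
      using True by (metis binomial_absorb_comp)
    from arg_cong[OF this, of real] show ?thesis
      using True unfolding d_def by (simp only: of_nat_mult of_nat_diff)
  qed (simp add: d_def binomial_eq_0)
  have 4: "(real k - real q) * c = (real q + 1) * d"
  proof (cases "q \<le> k")
    case True
    have "(k - q) * (k choose q) = Suc q * (k choose Suc q)"
      using True by (metis binomial_absorption binomial_absorb_comp)
    from arg_cong[OF this, of real] show ?thesis
      using True unfolding d_def c_def by (simp add: of_nat_diff algebra_simps)
  qed (simp add: c_def d_def binomial_eq_0)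
  show ?thesis
    unfolding 1 2 3 c_def[symmetric] d_def[symmetric] using 4 
    by (simp add: distrib_left left_diff_distrib right_diff_distrib) algebra
qed

definition degree_moment :: "nat \<Rightarrow> nat \<Rightarrow> nat \<Rightarrow> real" where
  "degree_moment n v p =
     measure_pmf.expectation (moran_forest n) (\<lambda>E. real (total_degree E v choose p))"

lemma degree_moment_neighbours:
  assumes "n \<ge> 2"
  shows "degree_moment n v p =
    measure_pmf.expectation (moran_forest n) (\<lambda>E. real (card (neighbours E v) choose p))"
  unfolding degree_moment_def
proof (intro integral_cong_AE)
  show "AE E in measure_pmf (moran_forest n).
      real (total_degree E v choose p) = real (card (neighbours E v) choose p)"
    using moran_forest_digraph[OF assms] moran_forest_asym[OF assms]
    by (auto simp: AE_measure_pmf_iff total_degree_eq_card_neighbours)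
qed simp_all

text \<open>Stationarity applied to the generator identity. It determines the moments one by one; the
  term \<open>of_bool (q = 0)\<close> comes from the resets of \<open>v\<close>, after which its degree is 1.\<close>
lemma degree_moment_recurrence:
  assumes "n \<ge> 2" "v \<in> {1..n}"
  shows "degree_moment n v (Suc q) =
    (of_bool (q = 0) + (1 - real q / (real n - 1)) * degree_moment n v q) / (real q + 2)"
proof -
  note dig = moran_forest_digraph[OF assms(1)]
  have fin: "finite (set_pmf (moran_forest n))"
    using dig finite_digraphs_on by (rule finite_subset)
  let ?E = "measure_pmf.expectation (moran_forest n)"
  define b where "b = degree_moment n v"
  have "real (n * (n - 1)) * b (Suc q) =
      ?E (\<lambda>E. \<Sum>p\<in>vertex_pairs n. real (card (neighbours (moran_step p E) v) choose Suc q))"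
    by (simp only: b_def degree_moment_neighbours[OF assms(1)] moran_forest_expectation_step[OF assms(1)])
  also have "\<dots> = ?E (\<lambda>E. (real n - 1) * of_bool (q = 0) +
      (real n - 1 - real q) * real (card (neighbours E v) choose q) +
      (real n - 1) * (real n - 1 - real (Suc q)) * real (card (neighbours E v) choose Suc q))"
  proof (intro integral_cong_AE)
    show "AE E in measure_pmf (moran_forest n).
      (\<Sum>p\<in>vertex_pairs n. real (card (neighbours (moran_step p E) v) choose Suc q)) =
      (real n - 1) * of_bool (q = 0) +
      (real n - 1 - real q) * real (card (neighbours E v) choose q) +
      (real n - 1) * (real n - 1 - real (Suc q)) * real (card (neighbours E v) choose Suc q)"
      unfolding AE_measure_pmf_iff
    proof
      fix E assume "E \<in> set_pmf (moran_forest n)"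
      with dig have E: "E \<in> digraphs_on n" by blast
      show "(\<Sum>p\<in>vertex_pairs n. real (card (neighbours (moran_step p E) v) choose Suc q)) =
        (real n - 1) * of_bool (q = 0) +
        (real n - 1 - real q) * real (card (neighbours E v) choose q) +
        (real n - 1) * (real n - 1 - real (Suc q)) * real (card (neighbours E v) choose Suc q)"
        unfolding sum_over_neighbours_moran_step[OF E assms(2), where f = "\<lambda>j. real (j choose Suc q)"]
        by (rule binomial_generator)
    qed
  qed simp_all
  also have "\<dots> = (real n - 1) * of_bool (q = 0) + (real n - 1 - real q) * b q +
      (real n - 1) * (real n - 1 - real (Suc q)) * b (Suc q)"
    by (simp only: b_def degree_moment_neighbours[OF assms(1)] Bochner_Integration.integral_add
        Bochner_Integration.integral_mult_right_zero integrable_measure_pmf_finite[OF fin]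
        measure_pmf.prob_space lebesgue_integral_const scaleR_conv_of_real) simp
  finally have stat: "real (n * (n - 1)) * b (Suc q) =
      (real n - 1) * of_bool (q = 0) + (real n - 1 - real q) * b q +
      (real n - 1) * (real n - 1 - real (Suc q)) * b (Suc q)" .
  \<comment> \<open>In terms of \<open>N = n - 1\<close> there are \<open>(N + 1) * N\<close> pairs, and a factor \<open>N\<close> cancels.\<close>
  define N where "N = real n - 1"
  have N: "N > 0" "real (n * (n - 1)) = (N + 1) * N" "real n = N + 1"
    using assms(1) by (simp_all add: N_def of_nat_diff)
  have "N * ((real q + 2) * b (Suc q)) = N * of_bool (q = 0) + (N - real q) * b q"
    using stat unfolding N(2) N(3) of_nat_Suc by algebra
  also have "N - real q = N * (1 - real q / N)"
    using N(1) by (simp add: right_diff_distrib)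
  also have "N * of_bool (q = 0) + N * (1 - real q / N) * b q =
      N * (of_bool (q = 0) + (1 - real q / N) * b q)"
    by (simp only: distrib_left mult.assoc)
  finally have "(real q + 2) * b (Suc q) = of_bool (q = 0) + (1 - real q / N) * b q"
    using N(1) by (subst (asm) mult_left_cancel) auto
  then show ?thesis
    unfolding b_def N_def by (subst nonzero_eq_divide_eq) (simp_all add: mult.commute)
qed

lemma degree_moment_0 [simp]: "degree_moment n v 0 = 1"
  by (simp add: degree_moment_def)

lemma degree_moment_nonneg: "degree_moment n v p \<ge> 0"
  by (simp add: degree_moment_def)

text \<open>A bound uniform in \<open>n\<close>, needed to pass to the limit inside the generating function. It is
  exactly the limiting value, because the factor \<open>1 - q / (n - 1)\<close> of the recurrence is at most 1.\<close>
lemma degree_moment_Suc_le: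
  assumes "n \<ge> 2" "v \<in> {1..n}"
  shows "degree_moment n v (Suc q) \<le> 2 / fact (Suc (Suc q))"
proof (induction q)
  case 0
  show ?case by (simp add: degree_moment_recurrence[OF assms])
next
  case (Suc q)
  have "degree_moment n v (Suc (Suc q)) =
      (1 - real (Suc q) / (real n - 1)) * degree_moment n v (Suc q) / (real q + 3)"
    by (subst degree_moment_recurrence[OF assms]) simp
  also have "\<dots> \<le> 1 * (2 / fact (Suc (Suc q))) / (real q + 3)"
    using Suc assms(1) degree_moment_nonneg[of n v "Suc q"]
    by (intro divide_right_mono mult_mono) auto
  also have "\<dots> = 2 / fact (Suc (Suc (Suc q)))"
    by (simp add: fact_Suc[of "Suc (Suc q)"] del: fact_Suc)
  finally show ?case .
qed

lemma total_degree_less: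
  assumes "n \<ge> 2" "v \<in> {1..n}" "E \<in> set_pmf (moran_forest n)"
  shows "total_degree E v < n"
proof -
  have E: "E \<in> digraphs_on n"
    using moran_forest_digraph[OF assms(1)] assms(3) by blast
  have "total_degree E v \<le> card ({1..n} - {v})"
    unfolding total_degree_eq_card_neighbours[OF moran_forest_asym[OF assms(1,3)] E]
    by (rule card_mono) (use neighbours_subset[OF E] in auto)
  with assms(1,2) show ?thesis by simp
qed

text \<open>By the binomial theorem, \<open>(1 + w) ^ k\<close> generates the coefficients \<open>k choose p\<close>. For fixed \<open>n\<close>
  the series is a finite sum, since degrees are smaller than \<open>n\<close>.\<close>
lemma degree_generating_function:
  fixes w :: complex
  assumes "n \<ge> 2" "v \<in> {1..n}"
  shows "measure_pmf.expectation (moran_forest n) (\<lambda>E. (1 + w) ^ total_degree E v) =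
    (\<Sum>p. of_real (degree_moment n v p) * w ^ p)"
proof -
  have fin: "finite (set_pmf (moran_forest n))"
    using moran_forest_digraph[OF assms(1)] finite_digraphs_on by (rule finite_subset)
  let ?E = "\<lambda>f. measure_pmf.expectation (moran_forest n) f"
  have "?E (\<lambda>E. (1 + w) ^ total_degree E v) =
      ?E (\<lambda>E. \<Sum>p<n. complex_of_real (real (total_degree E v choose p)) * w ^ p)"
  proof (intro integral_cong_AE)
    have "(1 + w) ^ total_degree E v =
        (\<Sum>p<n. complex_of_real (real (total_degree E v choose p)) * w ^ p)"
      if "E \<in> set_pmf (moran_forest n)" for E
    proof -
      have "(w + 1) ^ total_degree E v = (\<Sum>p\<le>total_degree E v. of_nat (total_degree E v choose p) * w ^ p)"
        by (simp add: binomial_ring)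
      also have "\<dots> = (\<Sum>p<n. of_nat (total_degree E v choose p) * w ^ p)"
        by (rule sum.mono_neutral_left) (use total_degree_less[OF assms that] in auto)
      finally show ?thesis by (simp add: add.commute)
    qed
    then show "AE E in measure_pmf (moran_forest n). (1 + w) ^ total_degree E v =
        (\<Sum>p<n. complex_of_real (real (total_degree E v choose p)) * w ^ p)"
      by (simp add: AE_measure_pmf_iff)
  qed simp_all
  also have "\<dots> = (\<Sum>p<n. of_real (degree_moment n v p) * w ^ p)"
    by (simp add: degree_moment_def integrable_measure_pmf_finite[OF fin] del: of_real_of_nat_eq)
  also have "\<dots> = (\<Sum>p. of_real (degree_moment n v p) * w ^ p)"
  proof (rule suminf_finite[symmetric])
    fix p assume "p \<notin> {..<n}"
    have "degree_moment n v p = ?E (\<lambda>E. 0 :: real)"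
      unfolding degree_moment_def
    proof (intro integral_cong_AE)
      show "AE E in measure_pmf (moran_forest n). real (total_degree E v choose p) = 0"
        using total_degree_less[OF assms] \<open>p \<notin> {..<n}\<close>
        by (fastforce simp: AE_measure_pmf_iff)
    qed simp_all
    then show "of_real (degree_moment n v p) * w ^ p = 0" by simp
  qed simp
  finally show ?thesis .
qed

lemma degree_moment_tendsto:
  assumes "\<And>n. n \<ge> 2 \<Longrightarrow> v n \<in> {1..n}"
  shows "(\<lambda>n. degree_moment n (v n) (Suc q)) \<longlonglongrightarrow> 2 / fact (Suc (Suc q))"
proof (induction q)
  have ev: "\<forall>\<^sub>F n in sequentially. (of_bool (q = 0) + (1 - real q / (real n - 1)) * degree_moment n (v n) q) / (real q + 2)
      = degree_moment n (v n) (Suc q)" for q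
    using eventually_ge_at_top[of 2]
  proof eventually_elim
    case (elim n)
    show ?case by (rule degree_moment_recurrence[OF elim assms[OF elim], symmetric])
  qed
  {
    case 0
    show ?case by (rule Lim_transform_eventually[OF _ ev]) simp
  next
    case (Suc q)
    have "(\<lambda>n. real (Suc q) / (real n - 1)) \<longlonglongrightarrow> 0"
      by real_asymp
    then have "(\<lambda>n. (of_bool (Suc q = 0) + (1 - real (Suc q) / (real n - 1)) * degree_moment n (v n) (Suc q)) / (real (Suc q) + 2))
       \<longlonglongrightarrow> (of_bool (Suc q = 0) + (1 - 0) * (2 / fact (Suc (Suc q)))) / (real (Suc q) + 2)"
      by (intro tendsto_intros Suc) auto
    also have "(of_bool (Suc q = 0) + (1 - 0) * (2 / fact (Suc (Suc q)))) / (real (Suc q) + 2) = (2 / fact (Suc (Suc (Suc q))) :: real)"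
      by (simp add: field_simps)
    finally show ?case by (rule Lim_transform_eventually[OF _ ev])
  }
qed

section \<open>The mixed Bernoulli-Poisson law\<close>

definition exp_tail :: "nat \<Rightarrow> real" where
  "exp_tail k = exp 1 - (\<Sum>j\<le>k. 1 / fact j)"

lemma inverse_fact_sums_exp: "(\<lambda>j. 1 / fact j) sums (exp 1 :: real)"
  using exp_converges[of "1 :: real"] by (simp add: divide_inverse)

lemma exp_tail_Suc: "exp_tail k = exp_tail (Suc k) + 1 / fact (Suc k)"
  by (simp add: exp_tail_def)

lemma exp_tail_sums: "(\<lambda>j. 1 / fact (j + Suc k)) sums exp_tail k"
  using sums_split_initial_segment[OF inverse_fact_sums_exp, of "Suc k"]
  by (simp add: exp_tail_def lessThan_Suc_atMost)

lemma exp_tail_nonneg: "exp_tail k \<ge> 0"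
  using exp_tail_sums[of k] by (rule sums_le[OF _ sums_zero, rotated]) simp

lemma exp_tail_le: "exp_tail k \<le> exp 1 / fact (Suc k)"
proof (rule sums_le[OF _ exp_tail_sums])
  show "(\<lambda>j. 1 / fact j / fact (Suc k)) sums (exp 1 / fact (Suc k) :: real)"
    by (rule sums_divide[OF inverse_fact_sums_exp])
  fix j
  have "fact j * fact (Suc k) \<le> (fact (j + Suc k) :: nat)"
    by (rule dvd_imp_le[OF fact_fact_dvd_fact]) simp
  then have "fact j * fact (Suc k) \<le> (fact (j + Suc k) :: real)"
    by (metis of_nat_fact of_nat_le_iff of_nat_mult)
  then show "1 / fact (j + Suc k) \<le> (1 / fact j / fact (Suc k) :: real)"
    by (simp add: frac_le del: fact_Suc)
qed

lemma exp_tail_eq_infsum: "exp_tail k = (\<Sum>\<^sub>\<infinity>j\<in>{k<..}. 1 / fact j)"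
proof -
  have "((\<lambda>j. 1 / fact (j + Suc k)) has_sum exp_tail k) UNIV"
    using exp_tail_sums by (rule sums_nonneg_imp_has_sum) simp
  also have "?this \<longleftrightarrow> ((\<lambda>j. 1 / fact j) has_sum exp_tail k) {k<..}"
    by (rule has_sum_reindex_bij_witness[of _ "\<lambda>j. j - Suc k" "\<lambda>j. j + Suc k"]) auto
  finally show ?thesis by (simp add: infsumI)
qed

text \<open>The Poisson probabilities for rate \<open>x\<close>; at \<open>x = 0\<close> the formula gives the point mass at 0.\<close>
definition poisson_weight :: "nat \<Rightarrow> real \<Rightarrow> real" where
  "poisson_weight k x = x ^ k / fact k * exp (- x)"

lemma poisson_weight_nonneg: "0 \<le> x \<Longrightarrow> 0 \<le> poisson_weight k x"
  by (simp add: poisson_weight_def)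

lemma continuous_poisson_weight [continuous_intros]: "continuous_on A (poisson_weight k)"
  unfolding poisson_weight_def by (intro continuous_intros) auto

definition mixture_weight :: "nat \<Rightarrow> real \<Rightarrow> real" where
  "mixture_weight k x =
     (1 - x) * (case k of 0 \<Rightarrow> 0 | Suc i \<Rightarrow> poisson_weight i x) + x * poisson_weight k x"

lemma mixture_weight_measurable [measurable]: "mixture_weight k \<in> borel_measurable borel"
proof -
  have "mixture_weight k = (\<lambda>x. (1 - x) * (case k of 0 \<Rightarrow> 0 | Suc i \<Rightarrow> poisson_weight i x) +
      x * poisson_weight k x)"
    by (rule ext) (simp add: mixture_weight_def)
  also have "\<dots> \<in> borel_measurable borel"
    by (intro borel_measurable_continuous_onI; cases k; auto intro!: continuous_intros)
  finally show ?thesis .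
qed

lemma pmf_ber_plus_poisson:
  assumes "0 \<le> x" "x \<le> 1"
  shows "pmf (ber_plus_poisson x) k = mixture_weight k x"
proof -
  define P where "P = (if x = 0 then return_pmf 0 else poisson_pmf x)"
  have P: "pmf P k = poisson_weight k x" for k
    using assms by (cases k) (auto simp: P_def poisson_weight_def pmf_return)
  have shift: "pmf (map_pmf Suc P) k = (case k of 0 \<Rightarrow> 0 | Suc i \<Rightarrow> poisson_weight i x)"
    by (cases k) (auto simp: pmf_map_inj' P pmf_eq_0_set_pmf)
  have "ber_plus_poisson x =
      bind_pmf (bernoulli_pmf (1 - x)) (\<lambda>b. map_pmf (\<lambda>k. of_bool b + k) P)"
    unfolding ber_plus_poisson_def P_def[symmetric] pair_pmf_def
    by (simp add: map_bind_pmf map_pmf_def bind_assoc_pmf bind_return_pmf)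
  moreover have "(+) (Suc 0) = Suc" "(+) (0 :: nat) = (\<lambda>k. k)" by auto
  ultimately show ?thesis
    using assms by (simp add: pmf_bind shift P map_pmf_ident[unfolded id_def] mixture_weight_def mult.commute)
qed

lemma DERIV_poisson_weight:
  "(poisson_weight k has_real_derivative
     (case k of 0 \<Rightarrow> 0 | Suc i \<Rightarrow> poisson_weight i x) - poisson_weight k x) (at x)"
proof -
  have "((\<lambda>x. x ^ k / fact k) has_real_derivative (case k of 0 \<Rightarrow> 0 | Suc i \<Rightarrow> x ^ i / fact i)) (at x)"
  proof (cases k)
    case (Suc i)
    have "((\<lambda>x. x ^ Suc i / fact (Suc i)) has_real_derivative real (Suc i) * x ^ i / fact (Suc i)) (at x)"
      by (rule DERIV_cdivide) (use DERIV_pow[of "Suc i" x] in simp)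
    with Suc show ?thesis by simp
  qed simp
  moreover have "((\<lambda>x. exp (- x)) has_real_derivative - exp (- x)) (at x)"
    by (auto intro!: derivative_eq_intros)
  ultimately show ?thesis
    unfolding poisson_weight_def
    by (rule DERIV_cong[OF DERIV_mult]) (simp split: nat.split)
qed

lemma DERIV_poisson_weight_sum:
  "((\<lambda>x. \<Sum>j\<le>k. poisson_weight j x) has_real_derivative - poisson_weight k x) (at x)"
proof (induction k)
  case 0
  show ?case using DERIV_poisson_weight[of 0 x] by simp
next
  case (Suc k)
  from DERIV_add[OF this DERIV_poisson_weight[of "Suc k" x]] show ?case by simp
qed

text \<open>The mixture weight has an elementary antiderivative. With \<open>q\<^sub>k\<close> for \<open>poisson_weight k\<close> and
  \<open>S\<^sub>k = q\<^sub>0 + \<dots> + q\<^sub>k\<close>, the derivatives telescope to \<open>S\<^sub>k' = - q\<^sub>k\<close> and \<open>q\<^sub>k' = q\<^sub>k\<^sub>-\<^sub>1 - q\<^sub>k\<close>, whence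
  \<open>(- 2 S\<^sub>k + (1 - x) q\<^sub>k)' = (1 - x) q\<^sub>k\<^sub>-\<^sub>1 + x q\<^sub>k\<close>. At \<open>x = 1\<close> only \<open>S\<^sub>k\<close> contributes; at \<open>x = 0\<close> the term
  \<open>q\<^sub>k\<close> contributes exactly when \<open>k = 0\<close>, which produces the correction there.\<close>
lemma nn_integral_mixture_weight:
  "(\<integral>\<^sup>+x. ennreal (mixture_weight k x) * indicator {0..1} x \<partial>lborel) =
    ennreal (2 / exp 1 * exp_tail k - of_bool (k = 0))"
proof -
  define F where "F x = - 2 * (\<Sum>j\<le>k. poisson_weight j x) + (1 - x) * poisson_weight k x" for x
  have "(\<integral>\<^sup>+x. ennreal (mixture_weight k x) * indicator {0..1} x \<partial>lborel) = ennreal (F 1 - F 0)"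
  proof (rule nn_integral_FTC_Icc)
    show "mixture_weight k \<in> borel_measurable borel" by simp
    show "(F has_real_derivative mixture_weight k x) (at x)" if "x \<in> {0..1}" for x
      unfolding F_def mixture_weight_def
      by (rule derivative_eq_intros DERIV_poisson_weight DERIV_poisson_weight_sum refl)+
         (simp add: algebra_simps)
    show "0 \<le> mixture_weight k x" if "x \<in> {0..1}" for x
      unfolding mixture_weight_def using that
      by (auto intro!: add_nonneg_nonneg mult_nonneg_nonneg poisson_weight_nonneg split: nat.split)
  qed simp
  also have "(\<Sum>j\<le>k. poisson_weight j 0) = 1"
    by (induction k) (auto simp: poisson_weight_def)
  moreover have "poisson_weight k 0 = of_bool (k = 0)"
    by (auto simp: poisson_weight_def)
  moreover have "(\<Sum>j\<le>k. poisson_weight j 1) = (exp 1 - exp_tail k) / exp 1"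
    by (simp add: poisson_weight_def exp_tail_def exp_minus sum_distrib_right divide_inverse)
  ultimately show ?thesis by (simp add: F_def field_simps)
qed

lemma uniform_measure_unit_interval:
  "uniform_measure (restrict_space lborel {0..1}) {0..1} = restrict_space lborel {0..1::real}"
proof (rule measure_eqI)
  let ?R = "restrict_space lborel {0..1::real}"
  fix B assume "B \<in> sets (uniform_measure ?R {0..1})"
  then have B: "B \<in> sets ?R" by simp
  then have "B \<subseteq> {0..1}" by (simp add: sets_restrict_space_iff)
  moreover have "{0..1} \<in> sets ?R" by (simp add: sets_restrict_space_iff)
  moreover have "emeasure ?R {0..1} = 1" by (simp add: emeasure_restrict_space)
  ultimately show "emeasure (uniform_measure ?R {0..1}) B = emeasure ?R B"
    using B by (simp add: Int_absorb1 divide_ennreal_def)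
qed simp

lemma measure_ber_plus_poisson_measurable:
  "(\<lambda>x. measure_pmf (ber_plus_poisson x)) \<in>
     restrict_space lborel {0..1} \<rightarrow>\<^sub>M subprob_algebra (count_space UNIV)"
proof (rule measurable_subprob_algebra)
  let ?U = "restrict_space lborel {0..1::real}"
  fix A :: "nat set"
  have weight [measurable]: "(\<lambda>x. ennreal (mixture_weight k x)) \<in> borel_measurable ?U" for k
    by (rule measurable_restrict_space1) simp
  have "(\<lambda>x. \<Sum>k. ennreal (mixture_weight k x) * indicator A k) \<in> borel_measurable ?U"
    by measurable
  also have "?this \<longleftrightarrow> (\<lambda>x. emeasure (measure_pmf (ber_plus_poisson x)) A) \<in> borel_measurable ?U"
  proof (rule measurable_cong)
    fix x :: real assume "x \<in> space ?U"
    then have x: "0 \<le> x" "x \<le> 1" by (auto simp: space_restrict_space)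
    have "emeasure (measure_pmf (ber_plus_poisson x)) A =
        (\<integral>\<^sup>+k. indicator A k \<partial>measure_pmf (ber_plus_poisson x))"
      by simp
    also have "\<dots> = (\<Sum>k. ennreal (mixture_weight k x) * indicator A k)"
      by (simp add: nn_integral_measure_pmf nn_integral_count_space_nat pmf_ber_plus_poisson[OF x])
    finally show "(\<Sum>k. ennreal (mixture_weight k x) * indicator A k) =
        emeasure (measure_pmf (ber_plus_poisson x)) A" ..
  qed
  finally show "(\<lambda>x. emeasure (measure_pmf (ber_plus_poisson x)) A) \<in> borel_measurable ?U" .
qed (auto intro: prob_space_imp_subprob_space measure_pmf.prob_space_axioms)

lemma emeasure_mixed_ber_poisson:
  "emeasure mixed_ber_poisson {k} = ennreal (2 / exp 1 * exp_tail k - of_bool (k = 0))"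
proof -
  have "emeasure mixed_ber_poisson {k} =
    (\<integral>\<^sup>+x. emeasure (measure_pmf (ber_plus_poisson x)) {k} \<partial>restrict_space lborel {0..1})"
    unfolding mixed_ber_poisson_def uniform_measure_unit_interval
    by (rule emeasure_bind[OF _ measure_ber_plus_poisson_measurable]) (auto simp: space_restrict_space)
  also have "\<dots> = (\<integral>\<^sup>+x. ennreal (mixture_weight k x) * indicator {0..1} x \<partial>lborel)"
    by (simp add: nn_integral_restrict_space)
       (intro nn_integral_cong, simp add: emeasure_pmf_single pmf_ber_plus_poisson split: split_indicator)
  finally show ?thesis by (simp only: nn_integral_mixture_weight)
qed

lemma sets_mixed_ber_poisson: "sets mixed_ber_poisson = UNIV"
  unfolding mixed_ber_poisson_def uniform_measure_unit_interval
  by (subst sets_bind[where N = "count_space UNIV"]) (auto simp: space_restrict_space)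

lemma prob_space_mixed_ber_poisson: "prob_space mixed_ber_poisson"
proof -
  interpret U: prob_space "restrict_space lborel {0..1::real}"
    by (rule prob_spaceI) (simp add: emeasure_restrict_space)
  show ?thesis
    unfolding mixed_ber_poisson_def uniform_measure_unit_interval
    by (rule U.prob_space_bind[OF _ measure_ber_plus_poisson_measurable])
       (auto simp: measure_pmf.prob_space_axioms)
qed

definition limit_degree :: "nat pmf" where
  "limit_degree = Abs_pmf mixed_ber_poisson"

lemma measure_limit_degree: "measure_pmf limit_degree = mixed_ber_poisson"
  unfolding limit_degree_def
proof (rule Abs_pmf_inverse, safe)
  interpret prob_space mixed_ber_poisson by (rule prob_space_mixed_ber_poisson)
  show "AE k in mixed_ber_poisson. measure mixed_ber_poisson {k} \<noteq> 0"
    by (subst AE_support_countable) (auto simp: sets_mixed_ber_poisson intro: exI[of _ UNIV])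
qed (auto simp: prob_space_mixed_ber_poisson sets_mixed_ber_poisson)

lemma pmf_limit_degree: "pmf limit_degree k = 2 / exp 1 * exp_tail k - of_bool (k = 0)"
proof -
  have "2 / exp 1 * exp_tail k - of_bool (k = 0) \<ge> 0"
    by (cases k) (use exp_ge_add_one_self[of 1] in \<open>auto simp: exp_tail_nonneg exp_tail_def[of 0] field_simps\<close>) 
  moreover have "ennreal (pmf limit_degree k) = emeasure mixed_ber_poisson {k}"
    by (simp add: emeasure_pmf_single flip: measure_limit_degree)
  ultimately show ?thesis by (simp add: emeasure_mixed_ber_poisson)
qed

lemma limit_degree_expectation:
  fixes f :: "nat \<Rightarrow> 'a :: {banach, second_countable_topology}"
  assumes "summable (\<lambda>k. norm (pmf limit_degree k *\<^sub>R f k))"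
    and "(\<lambda>k. pmf limit_degree k *\<^sub>R f k) sums s"
  shows "integrable (measure_pmf limit_degree) f"
    and "measure_pmf.expectation limit_degree f = s"
proof -
  have int: "integrable (count_space UNIV) (\<lambda>k. pmf limit_degree k *\<^sub>R f k)"
    using assms(1) by (simp add: integrable_count_space_nat_iff)
  then show "integrable (measure_pmf limit_degree) f"
    unfolding measure_pmf_eq_density by (subst integrable_density) auto
  have "measure_pmf.expectation limit_degree f = (\<integral>k. pmf limit_degree k *\<^sub>R f k \<partial>count_space UNIV)"
    unfolding measure_pmf_eq_density by (subst integral_density) auto
  also have "\<dots> = s"
    using assms(2) by (simp add: integral_count_space_nat[OF int] sums_iff)
  finally show "measure_pmf.expectation limit_degree f = s" .
qed

text \<open>The probabilities of the limit law without the correction at 0. They satisfy a first-order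
  difference equation valid for all \<open>k\<close>, so both the generating function and the moments can be
  summed by telescoping.\<close>
definition tail_weight :: "nat \<Rightarrow> real" where
  "tail_weight k = 2 / exp 1 * exp_tail k"

lemma tail_weight_nonneg: "0 \<le> tail_weight k"
  by (simp add: tail_weight_def exp_tail_nonneg)

lemma tail_weight_le: "tail_weight k \<le> 2 / fact k"
proof -
  have "tail_weight k \<le> 2 / exp 1 * (exp 1 / fact (Suc k))"
    unfolding tail_weight_def by (intro mult_left_mono exp_tail_le) simp
  also have "\<dots> = 2 / fact (Suc k)" by simp
  also have "\<dots> \<le> 2 / fact k"
    by (intro divide_left_mono fact_mono) auto
  finally show ?thesis .
qed

lemma tail_weight_Suc: "tail_weight k = tail_weight (Suc k) + 2 / exp 1 / fact (Suc k)"
  unfolding tail_weight_def by (subst exp_tail_Suc) (simp add: distrib_left)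

lemma pmf_limit_degree_tail: "pmf limit_degree k = tail_weight k - of_bool (k = 0)"
  by (simp add: pmf_limit_degree tail_weight_def)

lemma pmf_limit_degree_le: "pmf limit_degree k \<le> tail_weight k"
  by (simp add: pmf_limit_degree_tail)

lemma summable_tail_weight:
  fixes f :: "nat \<Rightarrow> real"
  assumes "\<And>k. \<bar>f k\<bar> \<le> r ^ k"
  shows "summable (\<lambda>k. tail_weight k * \<bar>f k\<bar>)"
proof (rule summable_comparison_test')
  have "summable (\<lambda>k. r ^ k / fact k)"
    using summable_exp[of r] by (simp add: divide_inverse mult.commute)
  from summable_mult[OF this, of 2] show "summable (\<lambda>k. 2 * (r ^ k / fact k))" .
  fix k :: nat
  have "tail_weight k * \<bar>f k\<bar> \<le> 2 / fact k * r ^ k"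
    by (intro mult_mono tail_weight_le assms) auto
  then show "norm (tail_weight k * \<bar>f k\<bar>) \<le> 2 * (r ^ k / fact k)"
    by (simp add: tail_weight_nonneg)
qed

lemma summable_limit_degree:
  fixes f :: "nat \<Rightarrow> 'a :: {banach, second_countable_topology}"
  assumes "\<And>k. norm (f k) \<le> r ^ k"
  shows "summable (\<lambda>k. norm (pmf limit_degree k *\<^sub>R f k))"
proof (rule summable_comparison_test')
  show "summable (\<lambda>k. tail_weight k * \<bar>norm (f k)\<bar>)"
    using assms by (intro summable_tail_weight) auto
  show "norm (norm (pmf limit_degree k *\<^sub>R f k)) \<le> tail_weight k * \<bar>norm (f k)\<bar>" for k
    using pmf_limit_degree_le[of k] by (simp add: mult_right_mono)
qed

section \<open>Generating function and factorial moments of the limit\<close>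

definition limit_gf :: "complex \<Rightarrow> complex" where
  "limit_gf z = (if z = 1 then 1 else 2 * ((exp (z - 1) - 1) / (z - 1)) - 1)"

text \<open>Multiplying the series by \<open>z - 1\<close> turns its coefficients into differences of consecutive
  weights, which are the coefficients of \<open>exp z\<close> up to a constant.\<close>
lemma tail_weight_sums:
  fixes z :: complex
  assumes "z \<noteq> 1"
  shows "(\<lambda>k. of_real (tail_weight k) * z ^ k) sums (2 * ((exp (z - 1) - 1) / (z - 1)))"
proof -
  define g where "g = (\<lambda>k. complex_of_real (tail_weight k) * z ^ k)"
  have "summable (\<lambda>k. norm (g k))"
    using summable_tail_weight[of "\<lambda>k. norm z ^ k" "norm z"]
    by (simp add: g_def norm_mult norm_power tail_weight_nonneg)
  then obtain S where S: "g sums S"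
    using summable_sums[OF summable_norm_cancel] by blast
  have e: "complex_of_real (exp 1) = exp 1"
    using exp_of_real[of 1, where 'a = complex] by simp
  have "(\<lambda>k. z * g k - g (Suc k)) sums (z * S - (S - g 0))"
    by (intro sums_diff sums_mult S) (use S in \<open>simp add: sums_Suc_iff\<close>)
  moreover have "z * g k - g (Suc k) = 2 / exp 1 * (z ^ Suc k / fact (Suc k))" for k
    by (simp add: g_def e tail_weight_Suc[of k] algebra_simps del: fact_Suc)
  moreover have "(\<lambda>k. 2 / exp 1 * (z ^ Suc k / fact (Suc k))) sums (2 / exp 1 * (exp z - 1))"
    using exp_converges[of z]
    by (intro sums_mult) (subst sums_Suc_iff, simp add: divide_inverse scaleR_conv_of_real mult.commute)
  ultimately have "z * S - (S - g 0) = 2 / exp 1 * (exp z - 1)"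
    by (simp add: sums_unique2)
  moreover have "g 0 = 2 / exp 1 * (exp 1 - 1)"
    by (simp add: g_def e tail_weight_def exp_tail_def)
  ultimately have "(z - 1) * S = 2 * (exp (z - 1) - 1)"
    by (simp add: exp_diff field_simps)
  with assms have "S = 2 * ((exp (z - 1) - 1) / (z - 1))"
    by (simp add: field_simps)
  with S show ?thesis by (simp add: g_def)
qed

lemma limit_degree_gf:
  fixes z :: complex
  shows "integrable (measure_pmf limit_degree) (\<lambda>k. z ^ k)"
    and "measure_pmf.expectation limit_degree (\<lambda>k. z ^ k) = limit_gf z"
proof -
  have summable: "summable (\<lambda>k. norm (pmf limit_degree k *\<^sub>R z ^ k))"
    by (rule summable_limit_degree[where r = "norm z"]) (simp add: norm_power)
  note sums = summable_sums[OF summable_norm_cancel[OF summable]]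
  show "integrable (measure_pmf limit_degree) (\<lambda>k. z ^ k)"
    by (rule limit_degree_expectation(1)[OF summable sums])
  show "measure_pmf.expectation limit_degree (\<lambda>k. z ^ k) = limit_gf z"
  proof (cases "z = 1")
    case False
    have "(\<lambda>k. of_real (tail_weight k) * z ^ k - (if k = 0 then 1 else 0)) sums
        (2 * ((exp (z - 1) - 1) / (z - 1)) - 1)"
      by (rule sums_diff[OF tail_weight_sums[OF False] sums_single])
    moreover have "of_real (tail_weight k) * z ^ k - (if k = 0 then 1 else 0) =
        pmf limit_degree k *\<^sub>R z ^ k" for k
      by (cases k) (simp_all add: pmf_limit_degree_tail scaleR_conv_of_real)
    ultimately have "(\<lambda>k. pmf limit_degree k *\<^sub>R z ^ k) sums limit_gf z"
      using False by (simp only: limit_gf_def if_False)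
    then show ?thesis
      by (rule limit_degree_expectation(2)[OF summable])
  qed (simp add: limit_gf_def)
qed

lemma mixture_integral_eq_limit_gf:
  "(LBINT x:{0..1}. (1 + (1 - complex_of_real x) * (z - 1)) * exp (complex_of_real x * (z - 1))) = limit_gf z"
proof (cases "z = 1")
  case True
  then show ?thesis by (simp add: limit_gf_def set_lebesgue_integral_def)
next
  case False
  define w where "w = z - 1"
  have w: "w \<noteq> 0" using False by (simp add: w_def)
  \<comment> \<open>Found by matching coefficients in \<open>((a + b * x) * exp (x * w))' = (1 + (1 - x) * w) * exp (x * w)\<close>.\<close>
  define F where "F x = ((2 + w) / w - x) * exp (x * w)" for x
  have "(F has_field_derivative (1 + (1 - x) * w) * exp (x * w)) (at x)" for x
    unfolding F_def using w by (auto intro!: derivative_eq_intros simp: field_simps)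
  then have "((\<lambda>x. F (of_real x)) has_vector_derivative
      (1 + (1 - complex_of_real x) * w) * exp (complex_of_real x * w)) (at x within {0..1})" for x
    by (rule has_vector_derivative_real_field)
  then have "(LBINT x:{0..1}. (1 + (1 - complex_of_real x) * w) * exp (complex_of_real x * w)) =
      F (of_real 1) - F (of_real 0)"
    unfolding set_lebesgue_integral_def
    by (intro integral_FTC_Icc) (auto intro!: continuous_intros)
  also have "\<dots> = 2 * ((exp w - 1) / w) - 1"
    using w by (simp add: F_def field_simps)
  finally show ?thesis using False by (simp add: limit_gf_def w_def)
qed

lemma binomial_over_fact_sums: "(\<lambda>k. real (k choose m) / fact k) sums (exp 1 / fact m)"
proof -
  have "(\<lambda>k. 1 / fact k / fact m) sums (exp 1 / fact m :: real)"
    by (rule sums_divide[OF inverse_fact_sums_exp])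
  moreover have "1 / fact k / fact m = real (k + m choose m) / fact (k + m)" for k
    using binomial_fact[of m "k + m", where 'a = real] by simp
  ultimately have "(\<lambda>k. real (k + m choose m) / fact (k + m)) sums (exp 1 / fact m)"
    by simp
  then show ?thesis
    by (rule iffD1[OF sums_zero_iff_shift, rotated]) (simp add: binomial_eq_0)
qed

text \<open>Summation by parts: since \<open>k choose p\<close> is the difference of \<open>k choose Suc p\<close>, the sum reduces to
  that of \<open>k choose Suc p\<close> against the differences of the weights, which are multiples of \<open>1 / k!\<close>.\<close>
lemma tail_weight_binomial_sums: "(\<lambda>k. tail_weight k * real (k choose p)) sums (2 / fact (Suc p))"
proof -
  define a where "a k = tail_weight k * real (k choose Suc p)" for k
  have "summable a"
    using summable_tail_weight[of "\<lambda>k. real (k choose Suc p)" 2]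
    unfolding a_def by (simp add: binomial_le_pow2 del: binomial_Suc_Suc)
  then have "a \<longlonglongrightarrow> 0" by (rule summable_LIMSEQ_zero)
  from telescope_sums[OF this] have "(\<lambda>k. a (Suc k) - a k) sums 0"
    by (simp add: a_def)
  moreover have "(\<lambda>k. real (Suc k choose Suc p) / fact (Suc k)) sums (exp 1 / fact (Suc p))"
    using binomial_over_fact_sums[of "Suc p"] by (subst sums_Suc_iff) simp
  then have "(\<lambda>k. 2 / exp 1 * (real (Suc k choose Suc p) / fact (Suc k))) sums (2 / exp 1 * (exp 1 / fact (Suc p)))"
    by (rule sums_mult)
  ultimately have "(\<lambda>k. a (Suc k) - a k + 2 / exp 1 * (real (Suc k choose Suc p) / fact (Suc k))) sums
      (0 + 2 / exp 1 * (exp 1 / fact (Suc p)))"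
    by (rule sums_add)
  moreover have "a (Suc k) - a k + 2 / exp 1 * (real (Suc k choose Suc p) / fact (Suc k)) =
      tail_weight k * real (k choose p)" for k
    unfolding a_def by (simp add: tail_weight_Suc[of k] algebra_simps add_divide_distrib del: fact_Suc)
  ultimately show ?thesis by simp
qed

lemma limit_degree_factorial_moment:
  assumes "p \<ge> 1"
  shows "integrable (measure_pmf limit_degree) (\<lambda>k. \<Prod>i<p. real k - real i)"
    and "measure_pmf.expectation limit_degree (\<lambda>k. \<Prod>i<p. real k - real i) = 2 / (real p + 1)"
proof -
  have falling: "(\<Prod>i<p. real k - real i) = fact p * real (k choose p)" for k
    by (simp add: binomial_gbinomial gbinomial_prod_rev atLeast0LessThan)
  have summable: "summable (\<lambda>k. norm (pmf limit_degree k *\<^sub>R real (k choose p)))"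
    by (rule summable_limit_degree[where r = 2])
       (simp add: binomial_le_pow2)
  have "pmf limit_degree k *\<^sub>R real (k choose p) = tail_weight k * real (k choose p)" for k
    using assms by (cases k) (auto simp: pmf_limit_degree_tail binomial_eq_0)
  then have sums: "(\<lambda>k. pmf limit_degree k *\<^sub>R real (k choose p)) sums (2 / fact (Suc p))"
    using tail_weight_binomial_sums[of p] by (simp only:)
  note binomial = limit_degree_expectation[OF summable sums]
  show "integrable (measure_pmf limit_degree) (\<lambda>k. \<Prod>i<p. real k - real i)"
    unfolding falling by (intro integrable_mult_right binomial(1))
  show "measure_pmf.expectation limit_degree (\<lambda>k. \<Prod>i<p. real k - real i) = 2 / (real p + 1)"
    unfolding falling by (simp add: binomial(2) add.commute)
qed

section \<open>Convergence in distribution\<close>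

text \<open>The limits of the binomial moments of the degree.\<close>
definition limit_moment :: "nat \<Rightarrow> real" where
  "limit_moment p = (if p = 0 then 1 else 2 / fact (Suc p))"

lemma limit_moment_sums:
  fixes w :: complex
  shows "(\<lambda>p. of_real (limit_moment p) * w ^ p) sums limit_gf (1 + w)"
proof (cases "w = 0")
  case True
  then show ?thesis
    using powser_sums_zero[of "\<lambda>p. complex_of_real (limit_moment p)"]
    by (simp add: limit_gf_def limit_moment_def)
next
  case False
  have "(\<lambda>p. w ^ Suc p / fact (Suc p)) sums (exp w - 1)"
    using exp_converges[of w]
    by (subst sums_Suc_iff) (simp add: divide_inverse scaleR_conv_of_real mult.commute)
  from sums_diff[OF sums_mult[OF this, of "2 / w"] sums_single[of 0 "\<lambda>_. 1"]]
  have "(\<lambda>p. 2 / w * (w ^ Suc p / fact (Suc p)) - (if p = 0 then 1 else 0)) sums (limit_gf (1 + w))"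
    using False by (simp add: limit_gf_def mult.commute)
  moreover have "2 / w * (w ^ Suc p / fact (Suc p)) - (if p = 0 then 1 else 0) =
      of_real (limit_moment p) * w ^ p" for p
    using False by (cases "p = 0") (simp_all add: limit_moment_def del: fact_Suc)
  ultimately show ?thesis by simp
qed

text \<open>Each binomial moment converges, and the uniform factorial bound dominates the series of the
  generating function at \<open>z = 1 + w\<close>, so Tannery's theorem allows the limit to be taken term by
  term.\<close>
lemma degree_gf_tendsto:
  fixes v :: "nat \<Rightarrow> nat" and z :: complex
  assumes v: "\<And>n. n \<ge> 2 \<Longrightarrow> v n \<in> {1..n}"
  shows "(\<lambda>n. measure_pmf.expectation (moran_forest n) (\<lambda>E. z ^ total_degree E (v n)))
    \<longlonglongrightarrow> limit_gf z"
proof -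
  define w where "w = z - 1"
  define a where "a p n = complex_of_real (degree_moment n (v n) p) * w ^ p" for p n
  have bound: "norm (a p n) \<le> 2 * (norm w ^ p / fact p)" if "n \<ge> 2" for p n
  proof -
    have "degree_moment n (v n) p \<le> 2 / fact p"
    proof (cases p)
      case (Suc q)
      have "degree_moment n (v n) (Suc q) \<le> 2 / fact (Suc (Suc q))"
        by (rule degree_moment_Suc_le[OF that v[OF that]])
      also have "\<dots> \<le> 2 / fact (Suc q)"
        by (intro divide_left_mono fact_mono) auto
      finally show ?thesis using Suc by simp
    qed simp
    then have "degree_moment n (v n) p * norm w ^ p \<le> 2 / fact p * norm w ^ p"
      by (intro mult_right_mono) auto
    then show ?thesis
      by (simp add: a_def norm_mult norm_power degree_moment_nonneg)
  qed
  have "(\<lambda>n. a p n) \<longlonglongrightarrow> of_real (limit_moment p) * w ^ p" for p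
  proof (cases p)
    case (Suc q)
    have "(\<lambda>n. degree_moment n (v n) p) \<longlonglongrightarrow> limit_moment p"
      using degree_moment_tendsto[of v q] v by (simp add: Suc limit_moment_def)
    then show ?thesis
      unfolding a_def by (intro tendsto_intros)
  qed (simp add: a_def limit_moment_def)
  moreover have "eventually (\<lambda>(p, n). norm (a p n) \<le> 2 * (norm w ^ p / fact p)) (at_top \<times>\<^sub>F sequentially)"
    using eventually_prodI[OF eventually_True eventually_ge_at_top[of "2 :: nat"]]
    by (rule eventually_mono) (unfold split_beta, rule bound, simp)
  moreover have "summable (\<lambda>p. 2 * (norm w ^ p / fact p))"
    using summable_exp[of "norm w"] by (intro summable_mult) (simp add: divide_inverse mult.commute)
  ultimately have "(\<lambda>n. \<Sum>p. a p n) \<longlonglongrightarrow> (\<Sum>p. of_real (limit_moment p) * w ^ p)"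
    by (intro tannerys_theorem[THEN conjunct2, THEN conjunct2]) auto
  also have "(\<Sum>p. of_real (limit_moment p) * w ^ p) = limit_gf z"
    using limit_moment_sums[of w] by (simp add: sums_iff w_def)
  finally show ?thesis
  proof (rule Lim_transform_eventually)
    show "\<forall>\<^sub>F n in sequentially. (\<Sum>p. a p n) =
        measure_pmf.expectation (moran_forest n) (\<lambda>E. z ^ total_degree E (v n))"
      using eventually_ge_at_top[of 2]
    proof eventually_elim
      case (elim n)
      show ?case
        using degree_generating_function[OF elim v[OF elim], of w] by (simp add: w_def a_def)
    qed
  qed
qed

lemma char_distr_pmf_nat:
  fixes X :: "'a \<Rightarrow> nat"
  shows "char (distr (measure_pmf p) borel (\<lambda>x. real (X x))) t =
    measure_pmf.expectation p (\<lambda>x. iexp t ^ X x)"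
proof -
  have "char (distr (measure_pmf p) borel (\<lambda>x. real (X x))) t =
      measure_pmf.expectation p (\<lambda>x. iexp (t * real (X x)))"
    unfolding char_def by (subst integral_distr) auto
  also have "(\<lambda>x. iexp (t * real (X x))) = (\<lambda>x. iexp t ^ X x)"
    by (simp add: mult_ac flip: exp_of_nat_mult)
  finally show ?thesis .
qed

text \<open>The characteristic function of an integer-valued variable is its generating function on the
  unit circle, so Levy's continuity theorem applies.\<close>
lemma degree_weak_convergence:
  fixes v :: "nat \<Rightarrow> nat"
  assumes "\<And>n. n \<ge> 2 \<Longrightarrow> v n \<in> {1..n}"
  shows "weak_conv_m
    (\<lambda>n. distr (measure_pmf (moran_forest n)) borel (\<lambda>E. real (total_degree E (v n))))
    (distr (measure_pmf limit_degree) borel real)"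
proof (rule levy_continuity)
  show "(\<lambda>n. char (distr (measure_pmf (moran_forest n)) borel (\<lambda>E. real (total_degree E (v n)))) t)
      \<longlonglongrightarrow> char (distr (measure_pmf limit_degree) borel real) t" for t
    unfolding char_distr_pmf_nat char_distr_pmf_nat[where X = "\<lambda>k. k"] limit_degree_gf(2)
    using assms by (rule degree_gf_tendsto)
qed (rule prob_space.real_distribution_distr[OF prob_space_measure_pmf], simp)+

theorem proposition4p3:
  fixes v :: "nat \<Rightarrow> nat"
  assumes "\<And>n. n \<ge> 2 \<Longrightarrow> v n \<in> {1..n}"
  shows "\<exists>D :: nat pmf.
    weak_conv_m
      (\<lambda>n. distr (measure_pmf (moran_forest n)) borel (\<lambda>E. real (total_degree E (v n))))
      (distr (measure_pmf D) borel real) \<and>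
    measure_pmf D = mixed_ber_poisson \<and>
    (\<forall>z :: complex.
       integrable (measure_pmf D) (\<lambda>k. z ^ k) \<and>
       measure_pmf.expectation D (\<lambda>k. z ^ k) =
         (LBINT x:{0..1}. (1 + (1 - complex_of_real x) * (z - 1)) * exp (complex_of_real x * (z - 1))) \<and>
       (LBINT x:{0..1}. (1 + (1 - complex_of_real x) * (z - 1)) * exp (complex_of_real x * (z - 1))) =
         (if z = 1 then 1 else 2 * ((exp (z - 1) - 1) / (z - 1)) - 1)) \<and>
    (\<forall>p :: nat. p \<ge> 1 \<longrightarrow>
       integrable (measure_pmf D) (\<lambda>k. \<Prod>i<p. real k - real i) \<and>
       measure_pmf.expectation D (\<lambda>k. \<Prod>i<p. real k - real i) = 2 / (real p + 1)) \<and>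
    pmf D 0 = 1 - 2 / exp 1 \<and>
    (\<forall>k :: nat. k \<ge> 1 \<longrightarrow>
       pmf D k = 2 / exp 1 * (\<Sum>\<^sub>\<infinity>j\<in>{k<..}. 1 / fact j))"
proof (intro exI[of _ limit_degree] conjI allI impI)
  show "weak_conv_m
      (\<lambda>n. distr (measure_pmf (moran_forest n)) borel (\<lambda>E. real (total_degree E (v n))))
      (distr (measure_pmf limit_degree) borel real)"
    using assms by (rule degree_weak_convergence)
  show "measure_pmf limit_degree = mixed_ber_poisson"
    by (rule measure_limit_degree)
next
  fix z :: complex
  show "integrable (measure_pmf limit_degree) (\<lambda>k. z ^ k)"
    by (rule limit_degree_gf)
  show "measure_pmf.expectation limit_degree (\<lambda>k. z ^ k) =
      (LBINT x:{0..1}. (1 + (1 - complex_of_real x) * (z - 1)) * exp (complex_of_real x * (z - 1)))"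
    unfolding mixture_integral_eq_limit_gf by (rule limit_degree_gf)
  show "(LBINT x:{0..1}. (1 + (1 - complex_of_real x) * (z - 1)) * exp (complex_of_real x * (z - 1))) =
      (if z = 1 then 1 else 2 * ((exp (z - 1) - 1) / (z - 1)) - 1)"
    unfolding mixture_integral_eq_limit_gf by (rule limit_gf_def)
next
  fix p :: nat
  assume "p \<ge> 1"
  then show "integrable (measure_pmf limit_degree) (\<lambda>k. \<Prod>i<p. real k - real i)"
    and "measure_pmf.expectation limit_degree (\<lambda>k. \<Prod>i<p. real k - real i) = 2 / (real p + 1)"
    by (rule limit_degree_factorial_moment)+
next
  show "pmf limit_degree 0 = 1 - 2 / exp 1"
    by (simp add: pmf_limit_degree exp_tail_def right_diff_distrib)
  show "pmf limit_degree k = 2 / exp 1 * (\<Sum>\<^sub>\<infinity>j\<in>{k<..}. 1 / fact j)" if "k \<ge> 1" for k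
    using that by (simp add: pmf_limit_degree exp_tail_eq_infsum)
qed

end
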